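(* Let $n\ge 2$ and let $P_n$ be the path on $n$ vertices. The $\chi^+$-chromatic mean of $P_n$ is $$\mu_{\chi^+}(P_n)=\begin{cases}\frac{3}{2}, & \text{if } n \text{ is even},\\ \frac{3n+1}{2n}, & \text{if } n \text{ is odd},\end{cases}$$ and the $\chi^+$-chromatic variance of $P_n$ is $$\sigma^2_{\chi^+}(P_n)=\begin{cases}\frac{1}{4}, & \text{if } n \text{ is even},\\ \frac{n^2-1}{4n^2}, & \text{if } n \text{ is odd}.\end{cases}$$
   Context: Graphs are simple, finite, connected and non-trivial (at least two vertices). A proper $k$-colouring $\mathcal{C}=\{c_1,\ldots,c_k\}$ of a graph $G$ assigns one of the colours $c_1,\ldots,c_k$ to each vertex so that adjacent vertices have different colours, every colour being used. Let $\theta(c_i)$ be the number of vertices with colour $c_i$, so $\sum_{i=1}^k\theta(c_i)=|V(G)|$. The colouring sum is $\omega_{\mathcal{C}}(G)=\sum_{i=1}^k i\,\theta(c_i)$. The colouring mean is $\mu_{\mathcal{C}}(G)=\frac{\sum_{i=1}^k i\,\theta(c_i)}{\sum_{i=1}^k\theta(c_i)}$ and the colouring variance is $\sigma^2_{\mathcal{C}}(G)=\frac{\sum_{i=1}^k i^2\,\theta(c_i)}{\sum_{i=1}^k\theta(c_i)}-\left(\frac{\sum_{i=1}^k i\,\theta(c_i)}{\sum_{i=1}^k\theta(c_i)}\right)^2$. The $\chi^+$-chromatic mean $\mu_{\chi^+}(G)$ and $\chi^+$-chromatic variance $\sigma^2_{\chi^+}(G)$ are the colouring mean and colouring variance with respect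 to a proper colouring $\mathcal{C}$ of $G$ with the minimum number $k=\chi(G)$ of colours for which the colouring sum $\omega_{\mathcal{C}}(G)$ is maximum among all proper colourings with $\chi(G)$ colours $c_1,\ldots,c_{\chi(G)}$. *)

theory Defs
  imports Complex_Main "Graph_Theory.Graph_Theory"
begin

text \<open>Undirected simple graphs are symmetric irreflexive pair digraphs (locale \<^locale>\<open>pair_graph\<close>):
  every undirected edge is represented by its two orientations.\<close>

definition path_graph :: "nat \<Rightarrow> nat pair_pre_digraph" where
  "path_graph n = \<lparr> pverts = {..<n},
     parcs = {(u, v). u < n \<and> v < n \<and> (v = Suc u \<or> u = Suc v)} \<rparr>"

lemma pair_graph_path_graph: "pair_graph (path_graph n)"
proof
  show "finite (parcs (path_graph n))"
    by (rule finite_subset[of _ "{..<n} \<times> {..<n}"]) (auto simp: path_graph_def)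
  show "symmetric (with_proj (path_graph n))"
    by (auto simp: symmetric_def sym_def arcs_ends_def arc_to_ends_def path_graph_def)
qed (auto simp: path_graph_def)

lemma connected_path_graph:
  assumes "n \<ge> 1"
  shows "connected (with_proj (path_graph n))"
proof -
  interpret pair_graph "path_graph n" by (rule pair_graph_path_graph)
  let ?G = "with_proj (path_graph n)"
  have from0: "0 \<rightarrow>\<^sup>*\<^bsub>?G\<^esub> k" if "k < n" for k
    using that
  proof (induction k)
    case 0
    then show ?case by (intro reachable_refl) (simp add: path_graph_def)
  next
    case (Suc k)
    then have "0 \<rightarrow>\<^sup>*\<^bsub>?G\<^esub> k" by simp
    moreover have "(k, Suc k) \<in> parcs (path_graph n)"
      using Suc.prems by (simp add: path_graph_def)
    ultimately show ?case by (rule reachable_adj_trans)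
  qed
  have "u \<rightarrow>\<^sup>*\<^bsub>mk_symmetric ?G\<^esub> v" if "u < n" "v < n" for u v
  proof -
    have "u \<rightarrow>\<^sup>*\<^bsub>?G\<^esub> v"
      using symmetric_reachable[OF sym_arcs from0[OF that(1)]] from0[OF that(2)]
      by (rule reachable_trans)
    then show ?thesis by (rule reachable_mk_symmetricI)
  qed
  moreover have "pverts (path_graph n) = {..<n}"
    by (simp add: path_graph_def)
  moreover have "0 \<in> {..<n}" using assms by simp
  ultimately show ?thesis
    unfolding connected_def strongly_connected_def by auto
qed

text \<open>The colour \<open>c\<^sub>i\<close> is represented by its index \<open>i\<close>; equality of the image of the
  vertex set with \<open>{1..k}\<close> expresses that exactly the \<open>k\<close> colours are used.\<close>

definition proper_colouring :: "'a pair_pre_digraph \<Rightarrow> nat \<Rightarrow> ('a \<Rightarrow> nat) \<Rightarrow> bool" where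
  "proper_colouring G k C \<longleftrightarrow>
     C ` pverts G = {1..k} \<and> (\<forall>(u, v) \<in> parcs G. C u \<noteq> C v)"

definition chromatic_number :: "'a pair_pre_digraph \<Rightarrow> nat" where
  "chromatic_number G = (LEAST k. \<exists>C. proper_colouring G k C)"

definition colour_count :: "'a pair_pre_digraph \<Rightarrow> ('a \<Rightarrow> nat) \<Rightarrow> nat \<Rightarrow> nat" where
  "colour_count G C i = card {v \<in> pverts G. C v = i}"

definition colouring_sum :: "'a pair_pre_digraph \<Rightarrow> nat \<Rightarrow> ('a \<Rightarrow> nat) \<Rightarrow> nat" where
  "colouring_sum G k C = (\<Sum>i=1..k. i * colour_count G C i)"

definition colouring_mean :: "'a pair_pre_digraph \<Rightarrow> nat \<Rightarrow> ('a \<Rightarrow> nat) \<Rightarrow> real" where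
  "colouring_mean G k C =
     (\<Sum>i=1..k. real i * real (colour_count G C i)) / (\<Sum>i=1..k. real (colour_count G C i))"

definition colouring_variance :: "'a pair_pre_digraph \<Rightarrow> nat \<Rightarrow> ('a \<Rightarrow> nat) \<Rightarrow> real" where
  "colouring_variance G k C =
     (\<Sum>i=1..k. (real i)\<^sup>2 * real (colour_count G C i)) / (\<Sum>i=1..k. real (colour_count G C i))
     - ((\<Sum>i=1..k. real i * real (colour_count G C i)) / (\<Sum>i=1..k. real (colour_count G C i)))\<^sup>2"

definition chi_plus_colouring :: "'a pair_pre_digraph \<Rightarrow> ('a \<Rightarrow> nat) \<Rightarrow> bool" where
  "chi_plus_colouring G C \<longleftrightarrow>
     proper_colouring G (chromatic_number G) C \<and>
     (\<forall>C'. proper_colouring G (chromatic_number G) C' \<longrightarrow>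
        colouring_sum G (chromatic_number G) C' \<le> colouring_sum G (chromatic_number G) C)"

text \<open>A graph may have several \<open>\<chi>\<^sup>+\<close>-colourings. A number is the \<open>\<chi>\<^sup>+\<close>-chromatic mean
  (variance) if such a colouring exists and every one of them has that mean (variance), so the
  predicates include that the value does not depend on the colouring chosen.\<close>

definition has_chi_plus_mean :: "'a pair_pre_digraph \<Rightarrow> real \<Rightarrow> bool" where
  "has_chi_plus_mean G m \<longleftrightarrow>
     (\<exists>C. chi_plus_colouring G C) \<and>
     (\<forall>C. chi_plus_colouring G C \<longrightarrow> colouring_mean G (chromatic_number G) C = m)"

definition has_chi_plus_variance :: "'a pair_pre_digraph \<Rightarrow> real \<Rightarrow> bool" where
  "has_chi_plus_variance G s \<longleftrightarrow>
     (\<exists>C. chi_plus_colouring G C) \<and>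
     (\<forall>C. chi_plus_colouring G C \<longrightarrow> colouring_variance G (chromatic_number G) C = s)"

end

theory Submission
  imports Defs
begin

text \<open>
  A path with at least one edge needs two colours, and a proper colouring with the colours 1 and 2
  is determined by the colour of its first vertex, because the colours must alternate along the
  path. So there are only two colourings to compare, exchanged by swapping the colours; their
  colour classes are the set of even positions, of size \<open>\<lceil>n/2\<rceil>\<close>, and the set of odd positions, of
  size \<open>\<lfloor>n/2\<rfloor>\<close>. Since the colouring sum is the number of vertices plus the number of vertices of
  colour 2, it is maximal exactly when colour 2 occurs \<open>\<lceil>n/2\<rceil>\<close> times
  (\<open>chi_plus_colour_counts_path\<close>). Hence every maximal colouring has the same two class sizes,
  even though for even \<open>n\<close> both colourings are maximal. The mean and the variance of a 2-colouring
  depend only on those sizes.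
\<close>

section \<open>Statistics of 2-colourings\<close>

lemma sum_1_to_2: "(\<Sum>i::nat = 1..2. f i) = f 1 + (f 2 :: 'a :: comm_monoid_add)"
proof -
  have "{1..2} = {1, 2::nat}"
    by auto
  then show ?thesis
    by simp
qed

lemma colouring_sum_2:
  "colouring_sum G 2 C = colour_count G C 1 + 2 * colour_count G C 2"
  by (simp only: colouring_sum_def sum_1_to_2 mult_1)

lemma colouring_mean_2:
  "colouring_mean G 2 C =
     (real (colour_count G C 1) + 2 * real (colour_count G C 2)) /
     (real (colour_count G C 1) + real (colour_count G C 2))"
  by (simp only: colouring_mean_def sum_1_to_2 of_nat_1 of_nat_numeral mult_1)

text \<open>A distribution on two consecutive integers has the variance \<open>p q\<close> of a Bernoulli
  distribution, with \<open>p\<close> and \<open>q\<close> the relative frequencies.\<close>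

lemma colouring_variance_2:
  assumes "colour_count G C 1 + colour_count G C 2 > 0"
  shows "colouring_variance G 2 C =
     real (colour_count G C 1) * real (colour_count G C 2) /
     (real (colour_count G C 1) + real (colour_count G C 2))\<^sup>2"
proof -
  define a b where "a = real (colour_count G C 1)" and "b = real (colour_count G C 2)"
  have pos: "a + b \<noteq> 0"
    using assms by (simp add: a_def b_def flip: of_nat_add)
  have "colouring_variance G 2 C = (a + 4 * b) / (a + b) - ((a + 2 * b) / (a + b))\<^sup>2"
    unfolding colouring_variance_def sum_1_to_2 a_def b_def by simp
  also have "(a + 4 * b) / (a + b) = (a + 4 * b) * (a + b) / (a + b)\<^sup>2"
    using pos by (simp add: power2_eq_square)
  also have "\<dots> - ((a + 2 * b) / (a + b))\<^sup>2 = ((a + 4 * b) * (a + b) - (a + 2 * b)\<^sup>2) / (a + b)\<^sup>2"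
    by (simp add: power_divide diff_divide_distrib)
  also have "(a + 4 * b) * (a + b) - (a + 2 * b)\<^sup>2 = a * b"
    by (simp add: algebra_simps power2_eq_square)
  finally show ?thesis
    by (simp add: a_def b_def)
qed

section \<open>Proper colourings of paths\<close>

lemma proper_colouring_path_iff:
  "proper_colouring (path_graph n) k C \<longleftrightarrow>
     C ` {..<n} = {1..k} \<and> (\<forall>v. Suc v < n \<longrightarrow> C v \<noteq> C (Suc v))"
proof -
  have "(\<forall>(u, v) \<in> parcs (path_graph n). C u \<noteq> C v) \<longleftrightarrow>
      (\<forall>v. Suc v < n \<longrightarrow> C v \<noteq> C (Suc v))"
    by (force simp: path_graph_def)
  then show ?thesis
    by (simp add: proper_colouring_def) (simp add: path_graph_def)
qed

lemma proper_colouring_path_range: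
  assumes "proper_colouring (path_graph n) k C" and "v < n"
  shows "C v \<in> {1..k}"
proof -
  have "C v \<in> C ` {..<n}"
    using assms(2) by simp
  with assms(1) show ?thesis
    by (simp add: proper_colouring_path_iff)
qed

lemma proper_2_colouring_path_alternating:
  assumes "n \<ge> 2"
  shows "proper_colouring (path_graph n) 2 (\<lambda>v. if even v then 2 else 1)"
proof -
  have "2 \<in> (\<lambda>v. if even v then 2 else 1 :: nat) ` {..<n}"
    using assms by (intro image_eqI[of _ _ 0]) auto
  moreover have "1 \<in> (\<lambda>v. if even v then 2 else 1 :: nat) ` {..<n}"
    using assms by (intro image_eqI[of _ _ 1]) auto
  moreover have "{1..2} = {1, 2::nat}"
    by auto
  ultimately have "(\<lambda>v. if even v then 2 else 1) ` {..<n} = {1..2::nat}"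
    by auto
  then show ?thesis
    by (simp add: proper_colouring_path_iff)
qed

lemma chromatic_number_path:
  assumes "n \<ge> 2"
  shows "chromatic_number (path_graph n) = 2"
  unfolding chromatic_number_def
proof (rule Least_equality)
  show "\<exists>C. proper_colouring (path_graph n) 2 C"
    using proper_2_colouring_path_alternating[OF assms] by blast
next
  fix k assume "\<exists>C. proper_colouring (path_graph n) k C"
  then obtain C where C: "proper_colouring (path_graph n) k C" ..
  then have "C 0 \<noteq> C 1"
    using assms by (simp add: proper_colouring_path_iff)
  moreover have "C 0 \<in> {1..k}" "C 1 \<in> {1..k}"
    using proper_colouring_path_range[OF C] assms by simp_all
  ultimately show "2 \<le> k"
    by auto
qed

lemma proper_2_colouring_path_forced:
  assumes "proper_colouring (path_graph n) 2 C" and "v < n"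
  shows "C v = (if even v then C 0 else 3 - C 0)"
  using assms(2)
proof (induction v)
  case 0
  then show ?case by simp
next
  case (Suc v)
  have range: "C w \<in> {1..2}" if "w < n" for w
    using proper_colouring_path_range[OF assms(1) that] .
  have "C v \<noteq> C (Suc v)"
    using assms(1) Suc.prems by (simp add: proper_colouring_path_iff)
  \<comment> \<open>Subtraction from 3 swaps the colours 1 and 2.\<close>
  then have "C (Suc v) = 3 - C v"
    using range[of v] range[of "Suc v"] Suc.prems by auto
  then show ?case
    using Suc range[of 0] by auto
qed

lemma card_even_below: "card {v. v < n \<and> even v} = (n + 1) div 2"
proof -
  have "bij_betw (\<lambda>i. 2 * i) {..<(n + 1) div 2} {v. v < n \<and> even v}"
    by (rule bij_betwI[of _ _ _ "\<lambda>v. v div 2"]) (auto elim!: evenE)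
  from bij_betw_same_card[OF this] show ?thesis
    by (simp only: card_lessThan)
qed

lemma card_odd_below: "card {v. v < n \<and> odd v} = n div 2"
proof -
  have "bij_betw (\<lambda>i. 2 * i + 1) {..<n div 2} {v. v < n \<and> odd v}"
    by (rule bij_betwI[of _ _ _ "\<lambda>v. v div 2"]) (auto elim!: oddE)
  from bij_betw_same_card[OF this] show ?thesis
    by (simp only: card_lessThan)
qed

lemma colour_counts_path_alternating:
  fixes C :: "nat \<Rightarrow> nat"
  assumes "\<And>v. v < n \<Longrightarrow> C v = (if even v then c else d)" and "c \<noteq> d"
  shows "colour_count (path_graph n) C c = (n + 1) div 2"
    and "colour_count (path_graph n) C d = n div 2"
proof -
  have "{v. v < n \<and> C v = c} = {v. v < n \<and> even v}"
    and "{v. v < n \<and> C v = d} = {v. v < n \<and> odd v}"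
    using assms(2) by (auto simp: assms(1) split: if_split_asm)
  then show "colour_count (path_graph n) C c = (n + 1) div 2"
    and "colour_count (path_graph n) C d = n div 2"
    unfolding colour_count_def path_graph_def pair_pre_digraph.simps lessThan_iff
    by (simp_all only: card_even_below card_odd_below)
qed

lemma proper_2_colouring_path_counts:
  assumes "n \<ge> 2" and "proper_colouring (path_graph n) 2 C"
  obtains (first_1) "colour_count (path_graph n) C 1 = (n + 1) div 2"
      "colour_count (path_graph n) C 2 = n div 2"
    | (first_2) "colour_count (path_graph n) C 1 = n div 2"
      "colour_count (path_graph n) C 2 = (n + 1) div 2"
proof -
  have "C 0 \<in> {1..2}"
    using proper_colouring_path_range[OF assms(2)] assms(1) by simp
  then consider "C 0 = 1" | "C 0 = 2"
    by force
  then show thesis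
  proof cases
    case 1
    then have "C v = (if even v then 1 else 2)" if "v < n" for v
      using proper_2_colouring_path_forced[OF assms(2) that] by simp
    from colour_counts_path_alternating[OF this] show thesis
      using first_1 by (metis one_eq_numeral_iff num.distinct(1))
  next
    case 2
    then have "C v = (if even v then 2 else 1)" if "v < n" for v
      using proper_2_colouring_path_forced[OF assms(2) that] by simp
    from colour_counts_path_alternating[OF this] show thesis
      using first_2 by (metis one_eq_numeral_iff num.distinct(1))
  qed
qed

section \<open>Colourings of paths with maximal colouring sum\<close>

lemma chi_plus_colouring_path_alternating:
  assumes "n \<ge> 2"
  shows "chi_plus_colouring (path_graph n) (\<lambda>v. if even v then 2 else 1)"
    (is "chi_plus_colouring ?P ?A")
proof -
  have A: "colour_count ?P ?A 1 = n div 2" "colour_count ?P ?A 2 = (n + 1) div 2"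
    using colour_counts_path_alternating[of n ?A 2 1] by simp_all
  have "colouring_sum ?P 2 C \<le> colouring_sum ?P 2 ?A" if "proper_colouring ?P 2 C" for C
    using assms that
    by (cases rule: proper_2_colouring_path_counts) (simp_all add: colouring_sum_2 A[simplified])
  then show ?thesis
    using proper_2_colouring_path_alternating[OF assms]
    by (simp add: chi_plus_colouring_def chromatic_number_path[OF assms])
qed

text \<open>The two possible distributions of class sizes have colouring sums \<open>n + \<lfloor>n/2\<rfloor>\<close> and
  \<open>n + \<lceil>n/2\<rceil>\<close>. If \<open>n\<close> is odd the first is strictly smaller, and if \<open>n\<close> is even the two
  distributions coincide.\<close>

lemma chi_plus_colour_counts_path:
  assumes "n \<ge> 2" and "chi_plus_colouring (path_graph n) C"
  shows "colour_count (path_graph n) C 1 = n div 2"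
    and "colour_count (path_graph n) C 2 = (n + 1) div 2"
proof -
  let ?P = "path_graph n" and ?A = "\<lambda>v::nat. if even v then 2 else 1 :: nat"
  have A: "colour_count ?P ?A 1 = n div 2" "colour_count ?P ?A 2 = (n + 1) div 2"
    using colour_counts_path_alternating[of n ?A 2 1] by simp_all
  have C: "proper_colouring ?P 2 C" and "colouring_sum ?P 2 ?A \<le> colouring_sum ?P 2 C"
    using assms proper_2_colouring_path_alternating[OF assms(1)]
    by (simp_all add: chi_plus_colouring_def chromatic_number_path)
  then have le: "n div 2 + 2 * ((n + 1) div 2)
      \<le> colour_count ?P C 1 + 2 * colour_count ?P C 2"
    by (simp only: colouring_sum_2 A)
  have "colour_count ?P C 1 = n div 2 \<and> colour_count ?P C 2 = (n + 1) div 2"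
    using assms(1) C
  proof (cases rule: proper_2_colouring_path_counts)
    case first_1
    with le have "(n + 1) div 2 = n div 2"
      by linarith
    with first_1 show ?thesis
      by simp
  next
    case first_2
    then show ?thesis
      by blast
  qed
  then show "colour_count ?P C 1 = n div 2" and "colour_count ?P C 2 = (n + 1) div 2"
    by blast+
qed

theorem proposition2p13:
  fixes n :: nat
  assumes "n \<ge> 2"
  shows "has_chi_plus_mean (path_graph n)
           (if even n then 3 / 2 else (3 * real n + 1) / (2 * real n)) \<and>
         has_chi_plus_variance (path_graph n)
           (if even n then 1 / 4 else ((real n)\<^sup>2 - 1) / (4 * (real n)\<^sup>2))"
proof -
  let ?P = "path_graph n"
  define a b where "a = real (n div 2)" and "b = real ((n + 1) div 2)"
  have sum: "a + b = real n"
    unfolding a_def b_def of_nat_add[symmetric] of_nat_eq_iff by linarith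
  have diff: "b = a + (if even n then 0 else 1)"
    unfolding a_def b_def by (cases "even n") (auto elim!: evenE oddE)
  have n: "real n > 0"
    using assms by simp
  have mean: "(a + 2 * b) / real n = (if even n then 3 / 2 else (3 * real n + 1) / (2 * real n))"
  proof -
    have "a + 2 * b = (if even n then 3 * real n / 2 else (3 * real n + 1) / 2)"
      using sum diff by (cases "even n") simp_all
    then show ?thesis
      using n by simp
  qed
  have "4 * (a * b) = (real n)\<^sup>2 - (b - a)\<^sup>2"
    unfolding sum[symmetric] by (simp add: power2_eq_square algebra_simps)
  then have "a * b = (if even n then (real n)\<^sup>2 / 4 else ((real n)\<^sup>2 - 1) / 4)"
    using diff by (cases "even n") simp_all
  then have variance: "a * b / (real n)\<^sup>2 =
      (if even n then 1 / 4 else ((real n)\<^sup>2 - 1) / (4 * (real n)\<^sup>2))"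
    using n by simp
  have "colouring_mean ?P 2 C = (a + 2 * b) / real n"
    and "colouring_variance ?P 2 C = a * b / (real n)\<^sup>2"
    if "chi_plus_colouring ?P C" for C
  proof -
    note counts = chi_plus_colour_counts_path[OF assms that]
    show "colouring_mean ?P 2 C = (a + 2 * b) / real n"
      by (simp only: colouring_mean_2 counts flip: a_def b_def sum)
    have "colour_count ?P C 1 + colour_count ?P C 2 > 0"
      unfolding counts using assms by linarith
    then show "colouring_variance ?P 2 C = a * b / (real n)\<^sup>2"
      by (simp only: colouring_variance_2 counts flip: a_def b_def sum)
  qed
  then show ?thesis
    using chi_plus_colouring_path_alternating[OF assms]
    by (auto simp only: has_chi_plus_mean_def has_chi_plus_variance_def
        chromatic_number_path[OF assms] mean variance)
qed

end
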